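(* Let $m\ge 2$, $1\le r\le n$, and let $F$ be a germ of biholomorphism of $\mathbb{C}^n$ fixing the origin $O$, with diagonalizable differential at $O$, that is $m$-resonant with respect to its first $r$ eigenvalues $\lambda_1,\dots,\lambda_r$ and of finite weighted order $k_0$. Let $f=\mathrm{id}+H_{k_0+1}$ be a parabolic shadow of $F$, with associated coefficients $a_{K,j}$ ($K\in\mathbb{N}^m$, $|K|=k_0$, $1\le j\le r$). If $v\in\mathbb{C}^m\setminus\{O\}$ is any representative of a degenerate characteristic direction for $f$ (i.e. $H_{k_0+1}(v)=0$), then $F$ cannot be $(f,v)$-parabolically-attracting; that is, it is not the case that $$\mathrm{Re}\left(\sum_{K\in\mathbb{N}^m,\ |K|=k_0}\frac{a_{K,j}}{\lambda_j}\,v^K\right)<0\quad\text{for all } j=1,\dots,r.$$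
   Context: Here $\mathbb{N}$ contains $0$; for a multi-index $L=(l_1,\dots,l_n)$ write $|L|=\sum l_h$, $z^L=z_1^{l_1}\cdots z_n^{l_n}$, $\lambda^L=\lambda_1^{l_1}\cdots\lambda_n^{l_n}$; $e_j$ is the $j$-th standard basis vector (also viewed as a multi-index). Resonances. Let $\lambda_1,\dots,\lambda_n$ be the eigenvalues of $dF_O$. A resonance is a pair $(j,L)$ with $1\le j\le n$, $L\in\mathbb{N}^n$, $|L|\ge2$ and $\lambda_j=\lambda^L$. The germ $F$ is $m$-resonant with respect to the first $r$ eigenvalues $\lambda_1,\dots,\lambda_r$ if there are $m$ multi-indices $P^1,\dots,P^m\in\mathbb{N}^r\times\{0\}^{n-r}$, linearly independent over $\mathbb{Q}$, such that the resonances $(j,L)$ with $1\le j\le r$ are precisely those with $L=e_j+k_1P^1+\cdots+k_mP^m$, where $k_1,\dots,k_m\in\mathbb{N}$ and $k_1+\cdots+k_m\ge1$. The $P^i$, taken in a fixed order, are called the ordered generators over $\mathbb{N}$ of the resonances; write $P^i=(p^i_1,\dots,p^i_r,0,\dots,0)$. Weighted order. By the Poincaré–Dulac theorem, for every large $l$, $F$ is holomorphically conjugate (fixing $O$) to a germ $$\widetilde F(z)=Dz+\sum_{s=1}^r\ \sum_{K=(k_1,\dots,k_m)\in\mathbb{N}^m,\ |K|\ge1}a_{K,s}\,z^{k_1P^1+\cdots+k_mP^m}z_s\,e_s+\sum_{s=r+1}^nR_s(z)e_s+O(\|z\|^l),$$ with $D=\mathrm{Diag}(\lambda_1,\dots,\lambda_n)$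 and $R_s(z)=O(\|z\|^2)$ for $s>r$ (only terms of degree $<l$ in the double sum matter). The weighted order of $F$ is the minimal $k_0=|K|\ge1$ such that $a_{K,s}\neq0$ for some $1\le s\le r$ (taking $l$ large enough); this is well defined, and it is $+\infty$ if no such coefficient exists. Parabolic shadow. If $k_0<+\infty$, a parabolic shadow of $F$ is the germ $f(u)=u+H_{k_0+1}(u)$ of $(\mathbb{C}^m,O)$ obtained from such a normalization (with $l$ large enough that all terms with $|K|\le k_0$ have degree $<l$), where, for $i=1,\dots,m$, the $i$-th component of $H_{k_0+1}$ is $$u_i\sum_{|K|=k_0}\left(p^i_1\frac{a_{K,1}}{\lambda_1}+\cdots+p^i_r\frac{a_{K,r}}{\lambda_r}\right)u^K.$$ The coefficients $a_{K,j}$ in the claim are those of this normalization. A characteristic direction for $f$ is a nonzero vector $v\in\mathbb{C}^m$ (or its class in projective space) with $H_{k_0+1}(v)=\lambda v$ for some $\lambda\in\mathbb{C}$; it is degenerate if $\lambda=0$ and non-degenerate otherwise. *)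

theory Defs
  imports "HOL-Analysis.Analysis" "HOL-Library.Landau_Symbols"
begin

section \<open>Multi-indices and coordinates\<close>

text \<open>
  Coordinates of \<open>\<complex>\<^sup>n\<close> are indexed by a finite linearly ordered type \<open>'n\<close>, so that it makes sense
  to speak of the first \<open>r\<close> of them. Multi-indices are functions into \<^typ>\<open>nat\<close>.
\<close>

definition first_indices :: "nat \<Rightarrow> 'n::{finite,linorder} set" where
  "first_indices r = {j. card {i. i < j} < r}"

lemma card_first_indices:
  assumes "r \<le> CARD('n::{finite,linorder})"
  shows "card (first_indices r :: 'n set) = r"
proof -
  define g where "g = (\<lambda>j::'n. card {i. i < j})"
  have mono: "g j < g k" if "j < k" for j k
    unfolding g_def using that by (intro psubset_card_mono) (auto intro: less_trans)
  have inj: "inj g"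
  proof (rule injI)
    fix j k assume "g j = g k"
    then show "j = k" using mono[of j k] mono[of k j] by (cases j k rule: linorder_cases) auto
  qed
  have "g j < CARD('n)" for j
    unfolding g_def by (intro psubset_card_mono) auto
  then have "range g \<subseteq> {..<CARD('n)}" by auto
  moreover have "card (range g) = CARD('n)" using inj by (rule card_image)
  ultimately have "range g = {..<CARD('n)}" by (intro card_subset_eq) auto
  moreover have "g ` first_indices r = range g \<inter> {..<r}"
    unfolding first_indices_def g_def by blast
  ultimately have "g ` first_indices r = {..<r}"
    using assms by auto
  then show ?thesis
    using card_image[OF inj_on_subset[OF inj subset_UNIV], of "first_indices r"] by simp
qed

definition mdeg :: "('i::finite \<Rightarrow> nat) \<Rightarrow> nat" where
  "mdeg L = (\<Sum>h\<in>UNIV. L h)"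

definition mpow :: "complex^'i \<Rightarrow> ('i \<Rightarrow> nat) \<Rightarrow> complex" where
  "mpow z L = (\<Prod>h\<in>UNIV. (z $ h) ^ L h)"

text \<open>The multi-index \<open>k\<^sub>1P\<^sup>1 + \<dots> + k\<^sub>mP\<^sup>m\<close>.\<close>

definition mcomb :: "('m::finite \<Rightarrow> 'n \<Rightarrow> nat) \<Rightarrow> ('m \<Rightarrow> nat) \<Rightarrow> 'n \<Rightarrow> nat" where
  "mcomb P K = (\<lambda>h. \<Sum>i\<in>UNIV. K i * P i h)"

section \<open>Germs of biholomorphisms and their differentials\<close>

text \<open>Holomorphy is real differentiability with a complex-linear derivative.\<close>

definition holomorphic_map_on :: "(complex^'n \<Rightarrow> complex^'k) \<Rightarrow> (complex^'n) set \<Rightarrow> bool" where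
  "holomorphic_map_on f U \<longleftrightarrow>
     open U \<and> (\<forall>z\<in>U. \<exists>A :: complex^'n^'k. (f has_derivative (\<lambda>h. A *v h)) (at z))"

text \<open>
  A germ at the origin is represented by a total function whose values away from the origin are
  irrelevant.
\<close>

definition biholomorphic_germ :: "(complex^'n \<Rightarrow> complex^'n) \<Rightarrow> bool" where
  "biholomorphic_germ F \<longleftrightarrow> F 0 = 0 \<and>
     (\<exists>U V G. 0 \<in> U \<and> homeomorphism U V F G \<and> holomorphic_map_on F U \<and> holomorphic_map_on G V)"

definition differential_at_origin :: "(complex^'n \<Rightarrow> complex^'n) \<Rightarrow> complex^'n^'n" where
  "differential_at_origin F = matrix (frechet_derivative F (at 0))"

definition diag_matrix :: "complex^'n \<Rightarrow> complex^'n^'n" where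
  "diag_matrix d = (\<chi> i j. if i = j then d $ i else 0)"

definition diagonalizable_matrix :: "complex^'n^'n \<Rightarrow> bool" where
  "diagonalizable_matrix A \<longleftrightarrow>
     (\<exists>(S :: complex^'n^'n) (d :: complex^'n).
        invertible S \<and> A = S ** diag_matrix d ** matrix_inv S)"

text \<open>\<open>lam\<close> lists the eigenvalues of \<open>A\<close>, repeated according to algebraic multiplicity.\<close>

definition eigenvalue_list :: "complex^'n^'n \<Rightarrow> complex^'n \<Rightarrow> bool" where
  "eigenvalue_list A lam \<longleftrightarrow> (\<forall>x. det (mat x - A) = (\<Prod>j\<in>UNIV. x - lam $ j))"

section \<open>Resonances\<close>

definition resonance :: "complex^'n \<Rightarrow> 'n \<Rightarrow> ('n \<Rightarrow> nat) \<Rightarrow> bool" where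
  "resonance lam j L \<longleftrightarrow> 2 \<le> mdeg L \<and> lam $ j = mpow lam L"

text \<open>
  The germ with eigenvalues \<open>lam\<close> is \<open>m\<close>-resonant with respect to the first \<open>r\<close> of them, with
  ordered generators \<open>P\<close>; here \<open>m\<close> is the cardinality of \<open>'m\<close>.
\<close>

definition resonance_generators ::
  "complex^'n::{finite,linorder} \<Rightarrow> nat \<Rightarrow> ('m::finite \<Rightarrow> 'n \<Rightarrow> nat) \<Rightarrow> bool" where
  "resonance_generators lam r P \<longleftrightarrow>
     (\<forall>i. \<forall>h. h \<notin> first_indices r \<longrightarrow> P i h = 0) \<and>
     inj P \<and> vec.independent (range (\<lambda>i. \<chi> h. rat_of_nat (P i h))) \<and>
     (\<forall>j\<in>first_indices r. \<forall>L. resonance lam j L \<longleftrightarrow>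
        (\<exists>K. 1 \<le> mdeg K \<and> L = (\<lambda>h. of_bool (h = j) + mcomb P K h)))"

section \<open>Resonant normal forms, weighted order and parabolic shadow\<close>

text \<open>
  The indices \<open>K\<close> with \<open>|K| \<ge> 1\<close> whose monomials \<open>z\<^sup>k\<^sup>P z\<^sub>s\<close> have degree less than \<open>l\<close>. Monomials of
  degree at least \<open>l\<close> are absorbed by the error term.
\<close>

definition low_terms :: "('m::finite \<Rightarrow> 'n::finite \<Rightarrow> nat) \<Rightarrow> nat \<Rightarrow> ('m \<Rightarrow> nat) set" where
  "low_terms P l = {K. 1 \<le> mdeg K \<and> mdeg (mcomb P K) + 1 < l}"

text \<open>
  \<open>F\<close> is conjugate by a germ of biholomorphism \<open>\<Phi>\<close> fixing the origin to a germ \<open>G\<close> in normal form up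
  to order \<open>l\<close> with coefficients \<open>a\<close>. The components of \<open>R\<close> in \<open>first_indices r\<close> are not used, and
  \<open>a K s\<close> is meaningful only for \<open>K \<in> low_terms P l\<close> and \<open>s \<in> first_indices r\<close>.
\<close>

definition normal_form ::
  "(complex^'n::{finite,linorder} \<Rightarrow> complex^'n::{finite,linorder}) \<Rightarrow>
   complex^'n::{finite,linorder} \<Rightarrow> nat \<Rightarrow> ('m::finite \<Rightarrow> 'n \<Rightarrow> nat) \<Rightarrow>
   nat \<Rightarrow> (('m \<Rightarrow> nat) \<Rightarrow> 'n \<Rightarrow> complex) \<Rightarrow> bool" where
  "normal_form F lam r P l a \<longleftrightarrow>
     (\<exists>\<Phi> G R E. biholomorphic_germ \<Phi> \<and> biholomorphic_germ G \<and>
        (\<forall>\<^sub>F z in nhds 0. \<Phi> (G z) = F (\<Phi> z)) \<and>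
        (\<forall>\<^sub>F z in nhds 0. G z = diag_matrix lam *v z
           + (\<Sum>s\<in>first_indices r. \<Sum>K\<in>low_terms P l.
                (a K s * mpow z (mcomb P K) * z $ s) *s axis s 1)
           + (\<Sum>s\<in>- first_indices r. (R z $ s) *s axis s 1)
           + E z) \<and>
        (\<forall>s\<in>- first_indices r. (\<lambda>z. R z $ s) \<in> O[at 0](\<lambda>z. of_real (norm z ^ 2))) \<and>
        (\<lambda>z. norm (E z)) \<in> O[at 0](\<lambda>z. norm z ^ l))"

definition least_weight ::
  "nat \<Rightarrow> ('m::finite \<Rightarrow> 'n::{finite,linorder} \<Rightarrow> nat) \<Rightarrow> nat \<Rightarrow> (('m \<Rightarrow> nat) \<Rightarrow> 'n \<Rightarrow> complex) \<Rightarrow> enat"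
  where
  "least_weight r P l a =
     Inf {enat (mdeg K) |K. K \<in> low_terms P l \<and> (\<exists>s\<in>first_indices r. a K s \<noteq> 0)}"

text \<open>
  The weighted order does not depend on the normal form chosen, provided \<open>l\<close> is large enough. It is
  infinite if no coefficient \<open>a K s\<close> is nonzero (the infimum of the empty set is \<open>\<infinity>\<close>).
\<close>

definition has_weighted_order ::
  "(complex^'n::{finite,linorder} \<Rightarrow> complex^'n::{finite,linorder}) \<Rightarrow>
   complex^'n::{finite,linorder} \<Rightarrow> nat \<Rightarrow> ('m::finite \<Rightarrow> 'n \<Rightarrow> nat) \<Rightarrow> enat \<Rightarrow> bool" where
  "has_weighted_order F lam r P k \<longleftrightarrow>
     (\<forall>\<^sub>F l in sequentially. \<forall>a. normal_form F lam r P l a \<longrightarrow> least_weight r P l a = k)"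

definition shadow_term ::
  "complex^'n::{finite,linorder} \<Rightarrow> nat \<Rightarrow> ('m::finite \<Rightarrow> 'n \<Rightarrow> nat) \<Rightarrow> nat \<Rightarrow>
   (('m \<Rightarrow> nat) \<Rightarrow> 'n \<Rightarrow> complex) \<Rightarrow> complex^'m \<Rightarrow> complex^'m" where
  "shadow_term lam r P k a u =
     (\<chi> i. u $ i * (\<Sum>K | mdeg K = k.
        (\<Sum>j\<in>first_indices r. of_nat (P i j) * (a K j / lam $ j)) * mpow u K))"

text \<open>
  \<open>f\<close> is the parabolic shadow obtained from a normal form of \<open>F\<close> with coefficients \<open>a\<close>, where \<open>k\<close> is
  the weighted order of \<open>F\<close>.
\<close>

definition parabolic_shadow ::
  "(complex^'n::{finite,linorder} \<Rightarrow> complex^'n::{finite,linorder}) \<Rightarrow>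
   complex^'n::{finite,linorder} \<Rightarrow> nat \<Rightarrow> ('m::finite \<Rightarrow> 'n \<Rightarrow> nat) \<Rightarrow>
   nat \<Rightarrow> (('m \<Rightarrow> nat) \<Rightarrow> 'n \<Rightarrow> complex) \<Rightarrow> (complex^'m \<Rightarrow> complex^'m) \<Rightarrow> bool" where
  "parabolic_shadow F lam r P k a f \<longleftrightarrow>
     has_weighted_order F lam r P (enat k) \<and>
     (\<exists>l. normal_form F lam r P l a \<and> (\<forall>K. mdeg K \<le> k \<longrightarrow> mdeg (mcomb P K) + 1 < l)) \<and>
     f = (\<lambda>u. u + shadow_term lam r P k a u)"

text \<open>
  For maps of the form \<open>f = id + H\<close> with \<open>H\<close> homogeneous, such as parabolic shadows, so that
  \<open>H v = f v - v\<close>.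
\<close>

definition characteristic_direction ::
  "(complex^'m \<Rightarrow> complex^'m) \<Rightarrow> complex^'m \<Rightarrow> complex \<Rightarrow> bool" where
  "characteristic_direction f v \<mu> \<longleftrightarrow> v \<noteq> 0 \<and> f v - v = \<mu> *s v"

definition degenerate_characteristic_direction ::
  "(complex^'m \<Rightarrow> complex^'m) \<Rightarrow> complex^'m \<Rightarrow> bool" where
  "degenerate_characteristic_direction f v \<longleftrightarrow> characteristic_direction f v 0"

text \<open>
  The condition depends on \<open>F\<close> and its shadow \<open>f\<close> through the eigenvalues \<open>lam\<close>, the weighted order
  \<open>k\<close> and the coefficients \<open>a\<close> of the normal form giving \<open>f\<close>.
\<close>

definition parabolically_attracting ::
  "complex^'n::{finite,linorder} \<Rightarrow> nat \<Rightarrow> nat \<Rightarrow> (('m::finite \<Rightarrow> nat) \<Rightarrow> 'n \<Rightarrow> complex) \<Rightarrow>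
   complex^'m \<Rightarrow> bool" where
  "parabolically_attracting lam r k a v \<longleftrightarrow>
     (\<forall>j\<in>first_indices r. Re (\<Sum>K | mdeg K = k. a K j / lam $ j * mpow v K) < 0)"

text \<open>The index sets of the sums above are finite, so that none of these sums is void.\<close>

lemma finite_mdeg_le: "finite {K :: 'm::finite \<Rightarrow> nat. mdeg K \<le> k}"
proof (rule finite_subset)
  show "{K :: 'm \<Rightarrow> nat. mdeg K \<le> k} \<subseteq> UNIV \<rightarrow>\<^sub>E {..k}"
  proof
    fix K :: "'m \<Rightarrow> nat" assume "K \<in> {K. mdeg K \<le> k}"
    then have "K i \<le> k" for i
      using member_le_sum[of i UNIV K] by (simp add: mdeg_def)
    then show "K \<in> UNIV \<rightarrow>\<^sub>E {..k}" by (simp add: PiE_def Pi_def)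
  qed
  show "finite (UNIV \<rightarrow>\<^sub>E {..k} :: ('m \<Rightarrow> nat) set)"
    by (intro finite_PiE) auto
qed

lemma finite_mdeg_eq: "finite {K :: 'm::finite \<Rightarrow> nat. mdeg K = k}"
  by (rule finite_subset[OF _ finite_mdeg_le[of k]]) auto

lemma resonance_generators_nonzero:
  assumes "resonance_generators lam r P"
  shows "\<exists>h. P i h \<noteq> 0"
proof (rule ccontr)
  assume "\<not> (\<exists>h. P i h \<noteq> 0)"
  then have "(\<chi> h. rat_of_nat (P i h)) = 0" by (simp add: vec_eq_iff)
  then have "0 \<in> range (\<lambda>i. \<chi> h. rat_of_nat (P i h))" by (metis rangeI)
  then have "vec.dependent (range (\<lambda>i. \<chi> h. rat_of_nat (P i h)))"
    by (rule vec.dependent_zero)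
  then show False
    using assms by (simp only: resonance_generators_def simp_thms)
qed

lemma finite_low_terms:
  assumes "resonance_generators lam r P"
  shows "finite (low_terms P l)"
proof (rule finite_subset[OF _ finite_mdeg_le[of l]])
  have "mdeg K \<le> mdeg (mcomb P K)" for K
  proof -
    have pos: "1 \<le> (\<Sum>h\<in>UNIV. P i h)" for i
    proof -
      obtain h where "P i h \<noteq> 0" using resonance_generators_nonzero[OF assms] by blast
      then show ?thesis using member_le_sum[of h UNIV "P i"] by simp
    qed
    have "mdeg K \<le> (\<Sum>i\<in>UNIV. K i * (\<Sum>h\<in>UNIV. P i h))"
      unfolding mdeg_def
    proof (rule sum_mono)
      show "K i \<le> K i * (\<Sum>h\<in>UNIV. P i h)" for i
        using mult_le_mono2[OF pos, of "K i" i] by simp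
    qed
    also have "\<dots> = mdeg (mcomb P K)"
      unfolding mdeg_def mcomb_def sum_distrib_left by (rule sum.swap)
    finally show ?thesis .
  qed
  then have "mdeg K \<le> l" if "mdeg (mcomb P K) + 1 < l" for K
    using that by (meson add_leD1 le_trans less_imp_le_nat)
  then show "low_terms P l \<subseteq> {K. mdeg K \<le> l}"
    by (auto simp: low_terms_def)
qed

end

theory Submission
  imports Defs
begin

text \<open>
  Put \<open>w\<^sub>j = \<Sum>\<^bsub>|K| = k\<^sub>0\<^esub> (a\<^bsub>K,j\<^esub> / \<lambda>\<^sub>j) v\<^sup>K\<close>. Exchanging the two sums shows that the \<open>i\<close>-th component of
  \<open>H(v)\<close>, where \<open>f = id + H\<close>, is \<open>v\<^sub>i \<Sum>\<^sub>j p\<^sup>i\<^sub>j w\<^sub>j\<close>. If \<open>v \<noteq> 0\<close> is degenerate, choose \<open>i\<close> with \<open>v\<^sub>i \<noteq> 0\<close>; then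
  \<open>\<Sum>\<^sub>j p\<^sup>i\<^sub>j w\<^sub>j = 0\<close>. The exponents \<open>p\<^sup>i\<^sub>j\<close> are natural numbers, and by linear independence of the
  generators they do not all vanish. Hence a nontrivial combination of the numbers \<open>Re w\<^sub>j\<close> with
  nonnegative weights is zero, so they cannot all be negative.
\<close>

lemma shadow_term_nth:
  "shadow_term lam r P k a u $ i =
     u $ i * (\<Sum>j\<in>first_indices r.
       of_nat (P i j) * (\<Sum>K | mdeg K = k. a K j / lam $ j * mpow u K))"
proof -
  have "(\<Sum>K | mdeg K = k.
          (\<Sum>j\<in>first_indices r. of_nat (P i j) * (a K j / lam $ j)) * mpow u K) =
        (\<Sum>j\<in>first_indices r.
          of_nat (P i j) * (\<Sum>K | mdeg K = k. a K j / lam $ j * mpow u K))"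
    unfolding sum_distrib_left sum_distrib_right
    by (subst sum.swap) (simp only: mult.assoc)
  then show ?thesis
    by (simp add: shadow_term_def)
qed

lemma resonance_generators_nonzero_first:
  assumes "resonance_generators lam r P"
  shows "\<exists>h\<in>first_indices r. P i h \<noteq> 0"
proof -
  obtain h where "P i h \<noteq> 0"
    using resonance_generators_nonzero[OF assms] by blast
  moreover have "\<forall>i h. h \<notin> first_indices r \<longrightarrow> P i h = 0"
    using assms unfolding resonance_generators_def by (rule conjunct1)
  ultimately have "h \<in> first_indices r" by metis
  with \<open>P i h \<noteq> 0\<close> show ?thesis by (rule bexI)
qed

lemma nat_weighted_sum_neg_Re_nonzero:
  fixes p :: "'a \<Rightarrow> nat" and w :: "'a \<Rightarrow> complex"
  assumes "finite A" and "\<And>j. j \<in> A \<Longrightarrow> Re (w j) < 0" and "\<exists>h\<in>A. p h \<noteq> 0"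
  shows "(\<Sum>j\<in>A. of_nat (p j) * w j) \<noteq> 0"
proof -
  obtain h where h: "h \<in> A" "p h \<noteq> 0" using assms(3) by blast
  have "(\<Sum>j\<in>A. real (p j) * Re (w j)) < (\<Sum>j\<in>A. 0)"
  proof (rule sum_strict_mono_ex1)
    show "\<forall>j\<in>A. real (p j) * Re (w j) \<le> 0"
      using assms(2) by (simp add: mult_nonneg_nonpos less_imp_le)
    show "\<exists>j\<in>A. real (p j) * Re (w j) < 0"
      using h assms(2)[of h] by (intro bexI[of _ h] mult_pos_neg) simp_all
  qed fact
  then have "Re (\<Sum>j\<in>A. of_nat (p j) * w j) < 0" by simp
  then show ?thesis by (metis less_irrefl zero_complex.sel(1))
qed

theorem proposition1:
  fixes F :: "complex^'n::{finite,linorder} \<Rightarrow> complex^'n::{finite,linorder}"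
    and lam :: "complex^'n::{finite,linorder}"
    and r k0 :: nat
    and P :: "'m::finite \<Rightarrow> 'n \<Rightarrow> nat"
    and a :: "('m \<Rightarrow> nat) \<Rightarrow> 'n \<Rightarrow> complex"
    and f :: "complex^'m \<Rightarrow> complex^'m"
    and v :: "complex^'m"
  assumes "2 \<le> CARD('m)"
    and "1 \<le> r" and "r \<le> CARD('n)"
    and "biholomorphic_germ F"
    and "diagonalizable_matrix (differential_at_origin F)"
    and "eigenvalue_list (differential_at_origin F) lam"
    and "resonance_generators lam r P"
    and "has_weighted_order F lam r P (enat k0)"
    and "parabolic_shadow F lam r P k0 a f"
    and "degenerate_characteristic_direction f v"
  shows "\<not> parabolically_attracting lam r k0 a v"
proof
  assume attr: "parabolically_attracting lam r k0 a v"
  define w where "w j = (\<Sum>K | mdeg K = k0. a K j / lam $ j * mpow v K)" for j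
  have "f = (\<lambda>u. u + shadow_term lam r P k0 a u)"
    using assms(9) by (simp add: parabolic_shadow_def)
  then have shadow_zero: "shadow_term lam r P k0 a v = 0" and "v \<noteq> 0"
    using assms(10)
    by (simp_all add: degenerate_characteristic_direction_def characteristic_direction_def)
  then obtain i where "v $ i \<noteq> 0" by (auto simp: vec_eq_iff)
  moreover have "v $ i * (\<Sum>j\<in>first_indices r. of_nat (P i j) * w j) = 0"
    using shadow_zero shadow_term_nth[of lam r P k0 a v i] by (simp add: w_def)
  ultimately have "(\<Sum>j\<in>first_indices r. of_nat (P i j) * w j) = 0" by simp
  moreover have "(\<Sum>j\<in>first_indices r. of_nat (P i j) * w j) \<noteq> 0"
  proof (rule nat_weighted_sum_neg_Re_nonzero)
    show "Re (w j) < 0" if "j \<in> first_indices r" for j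
      using attr that by (simp add: parabolically_attracting_def w_def)
    show "\<exists>h\<in>first_indices r. P i h \<noteq> 0"
      using assms(7) by (rule resonance_generators_nonzero_first)
  qed simp
  ultimately show False by contradiction
qed

end
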